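(* Let $X$ be a proper geodesic metric space. There exist a constant $M\le2$ and a function $\lambda(\phi,p,q)$, defined for sublinear functions $\phi$ and reals $p\ge1$, $q\ge0$, monotonically increasing in $p$ and in $q$, such that the following holds. Let $\rho$ be sublinear, $L\ge1$, $A\ge0$. Let $\alpha$ be a $\rho$-contracting geodesic ray in $X$ and let $\beta$ be a continuous $(L,A)$-quasi-geodesic ray in $X$ with $\alpha_0=\beta_0=o$. Given some $R$ and $J$, suppose there exists a point $x\in\alpha$ with $d(x,o)\ge R$ and $d(x,\beta)\le J$. Let $y$ be the last point on the subsegment of $\alpha$ between $o$ and $x$ such that $d(y,\beta)=\kappa(\rho,L,A)$. Then $$d(x,y)\le MJ+\lambda(\rho,L,A).$$ Thus $$d(o,y)\ge R-MJ-\lambda(\rho,L,A).$$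
   Context: A function $\rho$ on $[0,\infty)$ is sublinear if it is non-decreasing, eventually non-negative, and $\lim_{r\to\infty}\rho(r)/r=0$. For a closed subset $Z\subset X$ let $\pi_Z(x):=\{z\in Z\mid d(x,z)=d(x,Z)\}$. A closed subset $Z$ is $\rho$-contracting, for $\rho$ sublinear, if for all $x,y\in X$: $d(x,y)\le d(x,Z)$ implies $\operatorname{diam}(\pi_Z(x)\cup\pi_Z(y))\le\rho(d(x,Z))$. A geodesic ray is an isometric embedding of $[0,\infty)$. An $(L,A)$-quasi-geodesic ray is a map $\gamma\colon[0,\infty)\to X$ with $\frac1L|s-t|-A\le d(\gamma_s,\gamma_t)\le L|s-t|+A$ for all $s,t$, where $\gamma_t:=\gamma(t)$. Rays are conflated with their images. Define $\kappa(\rho,L,A):=\max\{3A,\,3L^2,\,1+\inf\{R>0\mid\forall r\ge R,\ 3L^2\rho(r)\le r\}\}$.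
   Formalization: If d(x,β) < κ(ρ,L,A), y is taken to be x itself rather than the last earlier point at distance exactly κ from β; with the latter the bound can fail, since β may stray to distance κ from α, return and then follow α forever, so d(x,y) is unbounded with J = 0. *)

theory Defs
  imports "HOL-Analysis.Analysis"
begin

text \<open>The ambient space is a whole type of class \<^class>\<open>metric_space\<close>. Functions and rays on
  the half-line are total functions on \<^typ>\<open>real\<close> of which only the values on
  \<^term>\<open>{0::real..}\<close> matter.\<close>

definition proper_space :: "'a::metric_space itself \<Rightarrow> bool"
  where "proper_space _ \<longleftrightarrow> (\<forall>(x::'a) r. compact (cball x r))"

definition geodesic_space :: "'a::metric_space itself \<Rightarrow> bool"
  where "geodesic_space _ \<longleftrightarrow>
    (\<forall>x y::'a. \<exists>g. g 0 = x \<and> g (dist x y) = y \<and>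
      (\<forall>s\<in>{0..dist x y}. \<forall>t\<in>{0..dist x y}. dist (g s) (g t) = \<bar>s - t\<bar>))"

definition sublinear :: "(real \<Rightarrow> real) \<Rightarrow> bool"
  where "sublinear \<rho> \<longleftrightarrow>
    mono_on {0..} \<rho> \<and> (\<forall>\<^sub>F r in at_top. 0 \<le> \<rho> r) \<and> ((\<lambda>r. \<rho> r / r) \<longlongrightarrow> 0) at_top"

definition closest_points :: "'a::metric_space set \<Rightarrow> 'a \<Rightarrow> 'a set"
  where "closest_points Z x = {z \<in> Z. dist x z = infdist x Z}"

definition contracting :: "(real \<Rightarrow> real) \<Rightarrow> 'a::metric_space set \<Rightarrow> bool"
  where "contracting \<rho> Z \<longleftrightarrow> closed Z \<and>
    (\<forall>x y. dist x y \<le> infdist x Z \<longrightarrow>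
      diameter (closest_points Z x \<union> closest_points Z y) \<le> \<rho> (infdist x Z))"

definition geodesic_ray :: "(real \<Rightarrow> 'a::metric_space) \<Rightarrow> bool"
  where "geodesic_ray \<gamma> \<longleftrightarrow> (\<forall>s\<ge>0. \<forall>t\<ge>0. dist (\<gamma> s) (\<gamma> t) = \<bar>s - t\<bar>)"

definition quasi_geodesic_ray :: "real \<Rightarrow> real \<Rightarrow> (real \<Rightarrow> 'a::metric_space) \<Rightarrow> bool"
  where "quasi_geodesic_ray L A \<gamma> \<longleftrightarrow>
    (\<forall>s\<ge>0. \<forall>t\<ge>0. 1 / L * \<bar>s - t\<bar> - A \<le> dist (\<gamma> s) (\<gamma> t) \<and>
      dist (\<gamma> s) (\<gamma> t) \<le> L * \<bar>s - t\<bar> + A)"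

definition ray_image :: "(real \<Rightarrow> 'a) \<Rightarrow> 'a set"
  where "ray_image \<gamma> = \<gamma> ` {0..}"

definition kappa :: "(real \<Rightarrow> real) \<Rightarrow> real \<Rightarrow> real \<Rightarrow> real"
  where "kappa \<rho> L A =
    Max {3 * A, 3 * L\<^sup>2, 1 + Inf {R. R > 0 \<and> (\<forall>r\<ge>R. 3 * L\<^sup>2 * \<rho> r \<le> r)}}"

text \<open>\<open>\<alpha> t\<close> is the last point of the segment from \<open>\<alpha> 0\<close> to \<open>\<alpha> s\<close> at distance exactly \<open>k\<close>
  from \<open>B\<close>. If \<open>\<alpha> 0 \<in> B\<close> and \<open>k \<ge> 0\<close>, the condition \<open>k \<le> d(\<alpha> s, B)\<close> is what ensures, by the
  intermediate value theorem, that there is such a point, and all later points of the segment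
  are then farther than \<open>k\<close> from \<open>B\<close>. If \<open>\<alpha> s\<close> itself is closer to \<open>B\<close> than \<open>k\<close>, there is
  nothing to leave and the point is \<open>\<alpha> s\<close>. (An earlier point at distance exactly \<open>k\<close>, left over
  from a previous excursion of \<open>B\<close>, is not meant: it may be arbitrarily far from \<open>\<alpha> s\<close>, even
  if \<open>\<alpha> s \<in> B\<close>.) In both cases this is the last point of the segment within distance \<open>k\<close>
  of \<open>B\<close>.\<close>

definition last_at_distance ::
    "(real \<Rightarrow> 'a::metric_space) \<Rightarrow> 'a set \<Rightarrow> real \<Rightarrow> real \<Rightarrow> real \<Rightarrow> bool"
  where "last_at_distance \<alpha> B k s t \<longleftrightarrow> t \<in> {0..s} \<and>
    (if k \<le> infdist (\<alpha> s) B
     then infdist (\<alpha> t) B = k \<and> (\<forall>u\<in>{0..s}. infdist (\<alpha> u) B = k \<longrightarrow> u \<le> t)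
     else t = s)"

end

(* Let k = kappa(rho, L, A). A quasi-geodesic staying at distance at least k from the contracting
   set moves along it much more slowly than along its own parameter: cutting it into steps as long
   as the current distance r to the set, each step moves the projection by at most
   rho(r) <= r / (3 L^2). Comparing with the lower quasi-geodesic bound, its projections are
   controlled by the distances of its end points to the set.

   Apply this to the part of beta between its last visit (within k) to the segment of alpha up to y
   and either its next visit to the ray of alpha beyond x, or, if there is none, the point of beta
   nearly closest to x. In the latter case let J be the distance from x to that point and D the
   distance from that point to alpha: it projects within 2 (J - D) + rho(D) of x, while the
   projection of the piece of beta adds only D plus a constant; since rho(D) <= D the total
   is at most 2 J plus a constant. *)
theory Submission
  imports Defs
begin

section \<open>The threshold \<open>kappa\<close> and its dependence on the data\<close>

lemma kappa_ge:
  shows "3 * A \<le> kappa \<rho> L A" "3 * L\<^sup>2 \<le> kappa \<rho> L A"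
    "1 + Inf {R. R > 0 \<and> (\<forall>r\<ge>R. 3 * L\<^sup>2 * \<rho> r \<le> r)} \<le> kappa \<rho> L A"
  unfolding kappa_def by (rule Max_ge; simp)+

text \<open>Makes the infimum in \<open>kappa\<close> a genuine one: since
  \<open>\<rho> r / r\<close> tends to 0, every multiple of \<open>\<rho>\<close> is eventually
  below the identity.\<close>

lemma sublinear_threshold_nonempty:
  assumes "sublinear \<rho>"
  shows "{R. R > 0 \<and> (\<forall>r\<ge>R. c * \<rho> r \<le> r)} \<noteq> {}"
proof -
  have "((\<lambda>r. c * (\<rho> r / r)) \<longlongrightarrow> c * 0) at_top"
    using assms unfolding sublinear_def by (intro tendsto_mult_left) auto
  then have "\<forall>\<^sub>F r in at_top. c * (\<rho> r / r) < 1"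
    by (rule order_tendstoD(2)) simp
  then obtain N where N: "\<And>r. r \<ge> N \<Longrightarrow> c * (\<rho> r / r) < 1"
    by (auto simp: eventually_at_top_linorder)
  have "c * \<rho> r \<le> r" if "r \<ge> max N 1" for r
    using N[of r] that by (simp add: divide_less_eq)
  then have "max N 1 \<in> {R. R > 0 \<and> (\<forall>r\<ge>R. c * \<rho> r \<le> r)}"
    by simp
  then show ?thesis by blast
qed

text \<open>The summand 1 in \<open>kappa\<close> puts \<open>r\<close> strictly above the infimum,
  so some admissible threshold lies below \<open>r\<close> whether or not the infimum is
  attained.\<close>

lemma rho_le_of_kappa_le:
  assumes "sublinear \<rho>" "kappa \<rho> L A \<le> r"
  shows "3 * L\<^sup>2 * \<rho> r \<le> r"
proof -
  let ?S = "{R. R > 0 \<and> (\<forall>r\<ge>R. 3 * L\<^sup>2 * \<rho> r \<le> r)}"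
  have "Inf ?S < r"
    using kappa_ge(3)[of L \<rho> A] assms(2) by simp
  then obtain R where "R \<in> ?S" "R < r"
    using cInf_lessD[OF sublinear_threshold_nonempty[OF assms(1)]] by blast
  then show ?thesis by simp
qed

text \<open>A larger \<open>L\<close> only shrinks the set of thresholds: the condition gets
  stronger where \<open>\<rho>\<close> is non-negative and is automatic where \<open>\<rho>\<close>
  is negative. Hence the infimum grows.\<close>

lemma kappa_mono:
  assumes "sublinear \<rho>" "1 \<le> L" "L \<le> L'" "A \<le> A'"
  shows "kappa \<rho> L A \<le> kappa \<rho> L' A'"
proof -
  let ?S = "\<lambda>L. {R. R > 0 \<and> (\<forall>r\<ge>R. 3 * L\<^sup>2 * \<rho> r \<le> r)}"
  have sq: "L\<^sup>2 \<le> L'\<^sup>2"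
    using assms by (intro power_mono) auto
  have "3 * L\<^sup>2 * \<rho> r \<le> r" if "r > 0" "3 * L'\<^sup>2 * \<rho> r \<le> r" for r
  proof (cases "0 \<le> \<rho> r")
    case True
    then have "3 * L\<^sup>2 * \<rho> r \<le> 3 * L'\<^sup>2 * \<rho> r"
      using sq by (intro mult_right_mono) auto
    then show ?thesis using that by simp
  next
    case False
    then have "3 * L\<^sup>2 * \<rho> r \<le> 0"
      by (intro mult_nonneg_nonpos) auto
    then show ?thesis using that(1) by linarith
  qed
  then have "?S L' \<subseteq> ?S L"
    by (smt (verit) mem_Collect_eq subsetI)
  then have "Inf (?S L) \<le> Inf (?S L')"
    by (intro cInf_superset_mono sublinear_threshold_nonempty assms(1))
      (auto intro!: bdd_belowI[of _ 0])
  then show ?thesis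
    using kappa_ge(1)[of A' \<rho> L'] kappa_ge(2,3)[of L' \<rho> A'] sq assms(4)
    by (subst kappa_def) simp
qed

text \<open>All thresholds are positive, so values at negative arguments, which are arbitrary in
  this encoding, never enter.\<close>

lemma kappa_cong:
  assumes "\<And>r. 0 \<le> r \<Longrightarrow> \<phi> r = \<psi> r"
  shows "kappa \<phi> L A = kappa \<psi> L A"
proof -
  have "{R. R > 0 \<and> (\<forall>r\<ge>R. 3 * L\<^sup>2 * \<phi> r \<le> r)} = {R. R > 0 \<and> (\<forall>r\<ge>R. 3 * L\<^sup>2 * \<psi> r \<le> r)}"
    using assms by (auto)
  then show ?thesis by (simp add: kappa_def)
qed

section \<open>Closest points on contracting sets and geodesic rays\<close>

lemma contracting_dist_le:
  assumes "contracting \<rho> Z" "dist x y \<le> infdist x Z"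
    "p \<in> closest_points Z x" "q \<in> closest_points Z y"
  shows "dist p q \<le> \<rho> (infdist x Z)"
proof -
  have "closest_points Z z \<subseteq> cball z (infdist z Z)" for z
    by (auto simp: closest_points_def)
  \<comment> \<open>\<open>diameter\<close> bounds distances only in bounded sets.\<close>
  then have "bounded (closest_points Z x \<union> closest_points Z y)"
    by (meson bounded_Un bounded_cball bounded_subset)
  then have "dist p q \<le> diameter (closest_points Z x \<union> closest_points Z y)"
    using assms(3,4) by (intro diameter_bounded_bound) auto
  then show ?thesis
    using assms(1,2) unfolding contracting_def by fastforce
qed

lemma geodesic_ray_continuous:
  assumes "geodesic_ray \<alpha>"
  shows "continuous_on {0..} \<alpha>"
  using assms unfolding geodesic_ray_def continuous_on_iff
  by (metis atLeast_iff dist_real_def)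

text \<open>Beyond the parameter \<open>?N\<close> the ray is farther from \<open>z\<close> than
  \<open>\<alpha> t0\<close> is, so only a compact set of parameters competes. A general
  \<open>T\<close> covers the whole ray, an initial segment and a tail.\<close>

lemma geodesic_ray_closest_exists:
  assumes "geodesic_ray \<alpha>" "closed T" "T \<subseteq> {0..}" "T \<noteq> {}"
  obtains u where "u \<in> T" "dist z (\<alpha> u) = infdist z (\<alpha> ` T)"
proof -
  obtain t0 where t0: "t0 \<in> T" using assms(4) by blast
  let ?N = "dist z (\<alpha> 0) + dist z (\<alpha> t0)"
  have far: "v - dist z (\<alpha> 0) \<le> dist z (\<alpha> v)" if "v \<ge> 0" for v
    using assms(1) that dist_triangle3[of "\<alpha> 0" "\<alpha> v" z] unfolding geodesic_ray_def by fastforce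
  have "compact (T \<inter> {0..?N})"
    using assms(2) by (simp add: closed_Int_compact)
  moreover have "t0 \<in> T \<inter> {0..?N}"
    using t0 far[of t0] assms(3) by auto
  moreover have "continuous_on (T \<inter> {0..?N}) (\<lambda>u. dist z (\<alpha> u))"
    using assms(3)
    by (intro continuous_on_dist continuous_on_const
        continuous_on_subset[OF geodesic_ray_continuous[OF assms(1)]]) auto
  ultimately obtain u where u: "u \<in> T \<inter> {0..?N}"
    "\<And>v. v \<in> T \<inter> {0..?N} \<Longrightarrow> dist z (\<alpha> u) \<le> dist z (\<alpha> v)"
    using continuous_attains_inf[of "T \<inter> {0..?N}" "\<lambda>u. dist z (\<alpha> u)"] by blast
  have "dist z (\<alpha> u) \<le> dist z (\<alpha> v)" if "v \<in> T" for v
  proof (cases "v \<le> ?N")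
    case True
    then show ?thesis using u(2) that assms(3) by auto
  next
    case False
    then show ?thesis
      using far[of v] u(2)[OF \<open>t0 \<in> T \<inter> {0..?N}\<close>] that assms(3) by force
  qed
  then have "dist z (\<alpha> u) \<le> infdist z (\<alpha> ` T)"
    using assms(4) by (auto simp: infdist_notempty intro!: cINF_greatest)
  moreover have "infdist z (\<alpha> ` T) \<le> dist z (\<alpha> u)"
    using u(1) by (intro infdist_le) auto
  ultimately show thesis using that u(1) by force
qed

section \<open>Projections of quasi-geodesics that stay far from a contracting set\<close>

text \<open>Since \<^term>\<open>\<rho> r\<close> is at most \<^term>\<open>r / (3 * L\<^sup>2)\<close> and \<^term>\<open>A\<close> at most \<^term>\<open>r / 3\<close>, a step from
  distance \<^term>\<open>r\<close> over a length \<^term>\<open>r\<close> takes time at least \<^term>\<open>(r - A) / L\<close>, which is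
  at least \<^term>\<open>2 * L\<close> times the motion of the projection. The steps go backwards from \<^term>\<open>v\<close>, so that
  the incomplete last step is paid for by the distance at \<^term>\<open>u\<close>.\<close>

lemma projection_le_time:
  fixes \<beta> :: "real \<Rightarrow> 'a::metric_space"
  assumes \<rho>: "sublinear \<rho>" and L: "1 \<le> L" and A: "0 \<le> A" and Z: "contracting \<rho> Z"
    and ne: "\<And>x. closest_points Z x \<noteq> {}"
    and \<beta>: "quasi_geodesic_ray L A \<beta>" "continuous_on {0..} \<beta>"
    and uv: "0 \<le> u" "u \<le> v"
    and far: "\<And>w. w \<in> {u..v} \<Longrightarrow> kappa \<rho> L A \<le> infdist (\<beta> w) Z"
    and p: "p \<in> closest_points Z (\<beta> u)" and q: "q \<in> closest_points Z (\<beta> v)"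
  shows "2 * L * dist p q \<le> (v - u) + infdist (\<beta> u) Z / L"
proof -
  define r where "r w = infdist (\<beta> w) Z" for w
  have step: "2 * L * \<rho> (r w) \<le> (r w - A) / L" and gap: "1 \<le> r w - A" if "kappa \<rho> L A \<le> r w" for w
  proof -
    have "3 * (L\<^sup>2 * \<rho> (r w)) \<le> r w" "3 * A \<le> r w" "3 * L\<^sup>2 \<le> r w"
      using rho_le_of_kappa_le[OF \<rho> that] kappa_ge(1)[of A \<rho> L] kappa_ge(2)[of L \<rho> A] that by auto
    moreover have "1 \<le> L\<^sup>2" using L by simp
    ultimately have "2 * (L\<^sup>2 * \<rho> (r w)) \<le> r w - A" "1 \<le> r w - A"
      by linarith+
    then show "2 * L * \<rho> (r w) \<le> (r w - A) / L" "1 \<le> r w - A"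
      using L by (auto simp: field_simps power2_eq_square)
  qed
  have upper: "(dist (\<beta> a) (\<beta> b) - A) / L \<le> b - a" if "0 \<le> a" "a \<le> b" for a b
  proof -
    have "dist (\<beta> a) (\<beta> b) \<le> L * \<bar>a - b\<bar> + A"
      using \<beta>(1)[unfolded quasi_geodesic_ray_def, rule_format, of a b] that by simp
    then show ?thesis using L that by (simp add: field_simps)
  qed
  \<comment> \<open>The last step, which may be incomplete: the end point \<open>\<beta> u\<close>
    already lies within \<open>r v\<close> of \<open>\<beta> v\<close>.\<close>
  have near: "2 * L * dist p q \<le> (v - u) + r u / L"
    if "u \<le> v" "kappa \<rho> L A \<le> r v" "q \<in> closest_points Z (\<beta> v)" "dist (\<beta> v) (\<beta> u) \<le> r v" for v q
  proof -
    have "2 * L * dist p q \<le> 2 * L * \<rho> (r v)"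
      using contracting_dist_le[OF Z _ that(3) p] that(4) L by (simp add: r_def dist_commute)
    also have "\<dots> \<le> (r v - A) / L" by (rule step[OF that(2)])
    also have "\<dots> \<le> (dist (\<beta> u) (\<beta> v) - A) / L + r u / L"
      using infdist_triangle[of "\<beta> v" Z "\<beta> u"] L
      by (simp add: r_def dist_commute add_divide_distrib[symmetric] divide_right_mono)
    also have "\<dots> \<le> (v - u) + r u / L"
      using upper[OF uv(1) that(1)] by simp
    finally show ?thesis .
  qed
  \<comment> \<open>\<open>n\<close> bounds the number of steps: by \<open>gap\<close>, each full
    step lowers \<open>(v - u) * L\<close> by at least 1.\<close>
  have "2 * L * dist p q \<le> (v - u) + r u / L"
    if "(v - u) * L \<le> real n" "u \<le> v" "\<And>w. w \<in> {u..v} \<Longrightarrow> kappa \<rho> L A \<le> r w"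
      "q \<in> closest_points Z (\<beta> v)" for n v q
    using that
  proof (induction n arbitrary: v q)
    case 0
    then have "v = u" using L by (simp add: mult_le_0_iff)
    then show ?case using near[of v q] 0 by (simp add: r_def infdist_nonneg)
  next
    case (Suc n)
    show ?case
    proof (cases "dist (\<beta> v) (\<beta> u) \<le> r v")
      case True
      then show ?thesis using near Suc.prems by auto
    next
      case False
      have "continuous_on {u..v} (\<lambda>w. dist (\<beta> v) (\<beta> w))"
        using uv(1) by (intro continuous_on_dist continuous_on_const
            continuous_on_subset[OF \<beta>(2)]) auto
      \<comment> \<open>A full step backwards, of length exactly the current distance to
        \<open>Z\<close>, the longest to which the contraction property applies.\<close>
      then obtain w where w: "u \<le> w" "w \<le> v" "dist (\<beta> v) (\<beta> w) = r v"
        using IVT2'[of "\<lambda>w. dist (\<beta> v) (\<beta> w)" v "r v" u] False Suc.prems(2)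
        by (auto simp: r_def infdist_nonneg)
      obtain q' where q': "q' \<in> closest_points Z (\<beta> w)" using ne by blast
      have kv: "kappa \<rho> L A \<le> r v" using Suc.prems(2,3) by simp
      have vw: "(r v - A) / L \<le> v - w"
        using upper[of w v] w uv(1) by (simp add: dist_commute)
      then have "r v - A \<le> (v - w) * L"
        using L by (simp add: field_simps)
      then have "(w - u) * L \<le> real n"
        using gap[OF kv] Suc.prems(1) by (simp add: algebra_simps)
      then have IH: "2 * L * dist p q' \<le> (w - u) + r u / L"
        using Suc.IH[of w q'] Suc.prems(3) w q' by auto
      have "dist q q' \<le> \<rho> (r v)"
        using contracting_dist_le[OF Z _ Suc.prems(4) q'] w(3) by (simp add: r_def)
      then have "2 * L * dist q q' \<le> 2 * L * \<rho> (r v)"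
        using L by (intro mult_left_mono) auto
      then have "2 * L * dist q q' \<le> v - w"
        using step[OF kv] vw by linarith
      moreover have "2 * L * dist p q \<le> 2 * L * (dist p q' + dist q q')"
        using L dist_triangle2[of p q q'] by (intro mult_left_mono) auto
      ultimately show ?thesis using IH by (simp add: distrib_left)
    qed
  qed
  from this[of v "nat \<lceil>(v - u) * L\<rceil>" q] show ?thesis
    using uv far q by (simp add: r_def real_nat_ceiling_ge)
qed

text \<open>The lower quasi-geodesic bound gives \<open>v - u\<close> at most \<open>L\<close> times
  a sum in which \<open>dist p q\<close> occurs once. The factor \<open>2 * L\<close> of the
  previous estimate absorbs that term and leaves \<open>L * dist p q\<close>.\<close>

lemma quasi_geodesic_image:
  fixes \<beta> :: "real \<Rightarrow> 'a::metric_space"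
  assumes \<rho>: "sublinear \<rho>" and L: "1 \<le> L" and A: "0 \<le> A" and Z: "contracting \<rho> Z"
    and ne: "\<And>x. closest_points Z x \<noteq> {}"
    and \<beta>: "quasi_geodesic_ray L A \<beta>" "continuous_on {0..} \<beta>"
    and uv: "0 \<le> u" "u \<le> v"
    and far: "\<And>w. w \<in> {u..v} \<Longrightarrow> kappa \<rho> L A \<le> infdist (\<beta> w) Z"
    and p: "p \<in> closest_points Z (\<beta> u)" and q: "q \<in> closest_points Z (\<beta> v)"
  shows "dist p q \<le> A + infdist (\<beta> v) Z + 2 * infdist (\<beta> u) Z"
proof -
  let ?u = "infdist (\<beta> u) Z" and ?v = "infdist (\<beta> v) Z"
  have "1 / L * (v - u) - A \<le> dist (\<beta> u) (\<beta> v)"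
    using \<beta>(1)[unfolded quasi_geodesic_ray_def, rule_format, of u v] uv by simp
  also have "\<dots> \<le> ?u + dist p q + ?v"
    using p q dist_triangle[of "\<beta> u" "\<beta> v" p] dist_triangle[of p "\<beta> v" q]
    by (simp add: closest_points_def dist_commute)
  finally have "v - u \<le> L * (A + ?u + ?v + dist p q)"
    using L by (simp add: field_simps)
  moreover have "?u / L \<le> L * ?u"
  proof -
    have "?u / L \<le> ?u * 1" using L infdist_nonneg[of "\<beta> u" Z] by (simp add: divide_le_eq mult_le_cancel_left1)
    also have "\<dots> \<le> ?u * L" using L infdist_nonneg[of "\<beta> u" Z] by (intro mult_left_mono) auto
    finally show ?thesis by (simp add: mult.commute)
  qed
  ultimately have "2 * L * dist p q \<le> L * (A + ?u + ?v + dist p q) + L * ?u"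
    using projection_le_time[OF assms] by linarith
  then have "L * dist p q \<le> L * (A + ?v + 2 * ?u)"
    by (simp add: algebra_simps)
  then show ?thesis using L by (simp add: mult_le_cancel_left)
qed

text \<open>Move from \<open>w\<close> towards \<open>x\<close> by the distance from
  \<open>w\<close> to \<open>Z\<close>. The point \<open>z\<close> reached has a projection within
  \<open>\<rho>\<close> of \<open>p\<close>, and this projection is at most twice as far from
  \<open>x\<close> as \<open>z\<close> is.\<close>

lemma contracting_projection_near:
  fixes x :: "'a::metric_space"
  assumes geo: "geodesic_space TYPE('a)" and Z: "contracting \<rho> Z"
    and ne: "\<And>x. closest_points Z x \<noteq> {}"
    and x: "x \<in> Z" and p: "p \<in> closest_points Z w"
  shows "dist x p \<le> 2 * (dist w x - infdist w Z) + \<rho> (infdist w Z)"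
proof -
  let ?D = "infdist w Z"
  have D: "0 \<le> ?D" "?D \<le> dist w x"
    using x by (auto simp: infdist_nonneg infdist_le)
  obtain g where g: "g 0 = w" "g (dist w x) = x"
    "\<And>s t. s \<in> {0..dist w x} \<Longrightarrow> t \<in> {0..dist w x} \<Longrightarrow> dist (g s) (g t) = \<bar>s - t\<bar>"
    using geo unfolding geodesic_space_def by metis
  define z where "z = g ?D"
  have wz: "dist w z = ?D" and zx: "dist z x = dist w x - ?D"
    using g(3)[of 0 ?D] g(3)[of ?D "dist w x"] g(1,2) D by (auto simp: z_def)
  obtain q where q: "q \<in> closest_points Z z" using ne by blast
  have "dist x q \<le> 2 * dist z x"
    using q infdist_le[OF x, of z] dist_triangle3[of x q z] by (simp add: closest_points_def)
  moreover have "dist p q \<le> \<rho> ?D"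
    using contracting_dist_le[OF Z _ p q] wz by simp
  ultimately show ?thesis
    using zx dist_triangle2[of x p q] by simp
qed

section \<open>The last point of the geodesic near the quasi-geodesic\<close>

text \<open>Otherwise the intermediate value theorem yields a point at distance exactly
  \<open>k\<close> later than \<open>t\<close>.\<close>

lemma infdist_gt_after_last:
  assumes \<alpha>: "continuous_on {0..} \<alpha>" and last: "last_at_distance \<alpha> B k s t"
    and s: "k \<le> infdist (\<alpha> s) B" and u: "t < u" "u \<le> s"
  shows "k < infdist (\<alpha> u) B"
proof (rule ccontr)
  assume "\<not> k < infdist (\<alpha> u) B"
  moreover have "0 \<le> t" using last by (simp add: last_at_distance_def)
  moreover have "continuous_on {u..s} (\<lambda>w. infdist (\<alpha> w) B)"
    using \<open>0 \<le> t\<close> u by (intro continuous_on_infdist continuous_on_subset[OF \<alpha>]) auto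
  ultimately obtain w where "u \<le> w" "w \<le> s" "infdist (\<alpha> w) B = k"
    using IVT'[of "\<lambda>w. infdist (\<alpha> w) B" u k s] s u by auto
  then show False
    using last s u \<open>0 \<le> t\<close> by (force simp: last_at_distance_def)
qed

text \<open>Between two visits the lower bound is known only strictly inside the interval;
  continuity extends it to the visiting times.\<close>

lemma continuous_ge_on_Icc:
  fixes f :: "real \<Rightarrow> real"
  assumes "continuous_on {a..b} f" "a < b" "\<And>w. a < w \<Longrightarrow> w < b \<Longrightarrow> k \<le> f w" "w \<in> {a..b}"
  shows "k \<le> f w"
  using continuous_ge_on_closure[of "{a<..<b}" f w k] assms by auto

lemma last_at_distance_bound:
  fixes \<alpha> :: "real \<Rightarrow> 'a::metric_space"
  assumes geo: "geodesic_space TYPE('a)" and \<rho>: "sublinear \<rho>" and L: "1 \<le> L" and A: "0 \<le> A"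
    and \<alpha>: "geodesic_ray \<alpha>" and Z: "contracting \<rho> (ray_image \<alpha>)"
    and \<beta>: "quasi_geodesic_ray L A \<beta>" "continuous_on {0..} \<beta>"
    and start: "\<alpha> 0 = \<beta> 0" and last: "last_at_distance \<alpha> (ray_image \<beta>) (kappa \<rho> L A) s t"
  shows "s - t \<le> 2 * infdist (\<alpha> s) (ray_image \<beta>) + (A + 3 * kappa \<rho> L A + 2)"
proof (cases "kappa \<rho> L A \<le> infdist (\<alpha> s) (ray_image \<beta>)")
  case False
  then have "t = s" using last by (simp add: last_at_distance_def)
  then show ?thesis
    using A kappa_ge(1)[of A \<rho> L] infdist_nonneg[of "\<alpha> s" "ray_image \<beta>"] by simp
next
  case True
  define k where "k = kappa \<rho> L A"
  define J where "J = infdist (\<alpha> s) (ray_image \<beta>)"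
  let ?Z = "ray_image \<alpha>"
  have k: "0 \<le> k" using kappa_ge(1)[of A \<rho> L] A by (simp add: k_def)
  have J: "0 \<le> J" by (simp add: J_def infdist_nonneg)
  have ts: "0 \<le> t" "t \<le> s" using last by (auto simp: last_at_distance_def)
  have \<alpha>d: "v - u \<le> dist (\<alpha> u) (\<alpha> v)" if "0 \<le> u" "0 \<le> v" for u v
    using \<alpha> that unfolding geodesic_ray_def by fastforce
  have ne: "closest_points ?Z x \<noteq> {}" for x
    using geodesic_ray_closest_exists[OF \<alpha>, of "{0..}" x]
    by (force simp: closest_points_def ray_image_def)
  have cont: "continuous_on T (\<lambda>w. infdist (\<beta> w) Y)" if "T \<subseteq> {0..}" for Y T
    using that by (intro continuous_on_infdist continuous_on_subset[OF \<beta>(2)])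
  \<comment> \<open>A slack of 1 replaces a closest point of \<open>\<beta>\<close>; doubled, it is
    the summand 2 of the final constant.\<close>
  obtain c where c: "0 \<le> c" "dist (\<alpha> s) (\<beta> c) < J + 1"
  proof -
    have "ray_image \<beta> \<noteq> {}" by (auto simp: ray_image_def)
    then have "\<exists>z\<in>ray_image \<beta>. dist (\<alpha> s) z < J + 1"
      using cInf_lessD[of "dist (\<alpha> s) ` ray_image \<beta>" "J + 1"]
      by (auto simp: J_def infdist_notempty)
    then show thesis using that by (auto simp: ray_image_def)
  qed
  \<comment> \<open>Visits up to time \<open>c\<close>: \<open>S1\<close> to the segment of
    \<open>\<alpha>\<close> ending at \<open>\<alpha> t\<close>, \<open>S2\<close> to the tail
    starting at \<open>\<alpha> s\<close>.\<close>
  define S1 where "S1 = {w \<in> {0..c}. infdist (\<beta> w) (\<alpha> ` {0..t}) \<le> k}"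
  define S2 where "S2 = {w \<in> {0..c}. infdist (\<beta> w) (\<alpha> ` {s..}) \<le> k}"
  have closed: "closed S1" "closed S2"
    unfolding S1_def S2_def
    by (intro continuous_on_closed_Collect_le cont; auto)+
  \<comment> \<open>Points of \<open>\<alpha>\<close> strictly between \<open>\<alpha> t\<close> and
    \<open>\<alpha> s\<close> are farther than \<open>k\<close> from \<open>\<beta>\<close>, so
    every visit to the ray belongs to \<open>S1\<close> or \<open>S2\<close>.\<close>
  have cover: "k < infdist (\<beta> w) ?Z" if w: "w \<in> {0..c}" "w \<notin> S1" "w \<notin> S2" for w
  proof (rule ccontr)
    assume *: "\<not> k < infdist (\<beta> w) ?Z"
    obtain u where u: "0 \<le> u" "dist (\<beta> w) (\<alpha> u) = infdist (\<beta> w) ?Z"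
      using geodesic_ray_closest_exists[OF \<alpha>, of "{0..}" "\<beta> w"] by (auto simp: ray_image_def)
    have "\<beta> w \<in> ray_image \<beta>" using w by (auto simp: ray_image_def)
    then have "infdist (\<alpha> u) (ray_image \<beta>) \<le> k"
      using infdist_le[of "\<beta> w" "ray_image \<beta>" "\<alpha> u"] u * by (simp add: dist_commute)
    then have "u \<le> t \<or> s \<le> u"
      using infdist_gt_after_last[OF geodesic_ray_continuous[OF \<alpha>] last True, of u]
      by (force simp: k_def)
    then have "infdist (\<beta> w) (\<alpha> ` {0..t}) \<le> k \<or> infdist (\<beta> w) (\<alpha> ` {s..}) \<le> k"
      using u * infdist_le2[of "\<alpha> u" _ "\<beta> w" k] by auto
    then show False using w by (auto simp: S1_def S2_def)
  qed
  have S1: "compact S1" "0 \<in> S1"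
  proof -
    have "S1 = {0..c} \<inter> S1" by (auto simp: S1_def)
    then show "compact S1" using closed(1) by (metis compact_Icc compact_Int_closed)
    have "\<beta> 0 \<in> \<alpha> ` {0..t}" using start ts by (auto simp: image_iff intro!: bexI[of _ 0])
    then show "0 \<in> S1" using c k by (simp add: S1_def)
  qed
  then obtain a where a: "a \<in> S1" "\<And>w. w \<in> S1 \<Longrightarrow> w \<le> a"
    using compact_attains_sup[of S1] by (metis empty_iff)
  have ac: "0 \<le> a" "a \<le> c" using a(1) by (auto simp: S1_def)
  obtain u where u: "0 \<le> u" "u \<le> t" "dist (\<beta> a) (\<alpha> u) \<le> k"
  proof (rule geodesic_ray_closest_exists[OF \<alpha>, of "{0..t}" "\<beta> a"])
    fix u assume "u \<in> {0..t}" "dist (\<beta> a) (\<alpha> u) = infdist (\<beta> a) (\<alpha> ` {0..t})"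
    then show thesis using that[of u] a(1) by (simp add: S1_def)
  qed (use ts in auto)
  have uZ: "\<alpha> u \<in> ?Z" using u by (auto simp: ray_image_def)
  \<comment> \<open>Lets \<open>\<alpha> u\<close> and \<open>\<alpha> u'\<close> serve as
    projections: at the ends of an excursion, being within \<open>k\<close> already means being
    closest.\<close>
  have closest: "w \<in> closest_points ?Z z" if "w \<in> ?Z" "dist z w \<le> k" "k \<le> infdist z ?Z" for w z
    using that infdist_le[OF that(1), of z] by (simp add: closest_points_def)
  have Za: "infdist (\<beta> a) ?Z \<le> k" using infdist_le2[OF uZ u(3)] .
  show ?thesis
  proof (cases "S2 \<inter> {a..} = {}")
    case False
    have "compact (S2 \<inter> {a..c})"
      by (intro closed_Int_compact closed(2) compact_Icc)
    moreover have "S2 \<inter> {a..c} \<noteq> {}" using False by (auto simp: S2_def)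
    ultimately obtain a' where a': "a' \<in> S2 \<inter> {a..c}" "\<And>w. w \<in> S2 \<inter> {a..c} \<Longrightarrow> a' \<le> w"
      using compact_attains_inf[of "S2 \<inter> {a..c}"] by metis
    obtain u' where u': "s \<le> u'" "dist (\<beta> a') (\<alpha> u') \<le> k"
    proof (rule geodesic_ray_closest_exists[OF \<alpha>, of "{s..}" "\<beta> a'"])
      fix u assume "u \<in> {s..}" "dist (\<beta> a') (\<alpha> u) = infdist (\<beta> a') (\<alpha> ` {s..})"
      then show thesis using that[of u] a'(1) by (simp add: S2_def)
    qed (use ts in auto)
    have "s - t \<le> dist (\<alpha> u) (\<alpha> u')"
      using \<alpha>d[of u u'] u u' ts by linarith
    \<comment> \<open>Each end of the excursion is within \<open>k\<close> of the ray, and the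
      starting end counts twice.\<close>
    also have "\<dots> \<le> A + 3 * k"
    proof (cases "a = a'")
      case True
      then show ?thesis
        using u(3) u'(2) dist_triangle3[of "\<alpha> u" "\<alpha> u'" "\<beta> a"] A k by simp
    next
      case False
      then have "a < a'" using a'(1) by auto
      have between: "k \<le> infdist (\<beta> w) ?Z" if "a < w" "w < a'" for w
        using cover[of w] a(2)[of w] a'(1) a'(2)[of w] that ac by force
      have far: "k \<le> infdist (\<beta> w) ?Z" if "w \<in> {a..a'}" for w
        by (rule continuous_ge_on_Icc[OF cont \<open>a < a'\<close> between that]) (use ac in auto)
      have u'Z: "\<alpha> u' \<in> ?Z" using u' ts by (auto simp: ray_image_def)
      have "dist (\<alpha> u) (\<alpha> u') \<le> A + infdist (\<beta> a') ?Z + 2 * infdist (\<beta> a) ?Z"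
        using far \<open>a < a'\<close> ac u(3) u'(2)
        by (intro quasi_geodesic_image[OF \<rho> L A Z ne \<beta>] closest uZ u'Z) (auto simp: k_def)
      then show ?thesis using Za infdist_le2[OF u'Z u'(2)] by linarith
    qed
    finally show ?thesis using J by (simp add: k_def J_def)
  next
    case none: True
    have "s - t \<le> dist (\<alpha> s) (\<alpha> u)"
      using \<alpha>d[of u s] u ts by (simp add: dist_commute)
    also have "\<dots> \<le> 2 * (J + 1) + (A + 3 * k)"
    proof (cases "a = c")
      case True
      then show ?thesis
        using u(3) c(2) dist_triangle[of "\<alpha> s" "\<alpha> u" "\<beta> a"] A k J by simp
    next
      case False
      \<comment> \<open>No visit follows \<open>a\<close>, so the piece of \<open>\<beta>\<close> up
        to \<open>c\<close> is an excursion whose end may be far from the ray.\<close>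
      then have "a < c" using ac by simp
      have far': "k < infdist (\<beta> w) ?Z" if "a < w" "w \<le> c" for w
        using cover[of w] a(2)[of w] none that ac by force
      have far: "k \<le> infdist (\<beta> w) ?Z" if "w \<in> {a..c}" for w
        by (rule continuous_ge_on_Icc[OF cont \<open>a < c\<close> _ that]) (use ac far' in \<open>auto intro: less_imp_le\<close>)
      define D where "D = infdist (\<beta> c) ?Z"
      obtain p where p: "p \<in> closest_points ?Z (\<beta> c)" using ne by blast
      have "dist (\<alpha> u) p \<le> A + infdist (\<beta> c) ?Z + 2 * infdist (\<beta> a) ?Z"
        using far ac u(3)
        by (intro quasi_geodesic_image[OF \<rho> L A Z ne \<beta> ac _ _ p] closest uZ) (auto simp: k_def)
      moreover have "dist (\<alpha> s) p \<le> 2 * (dist (\<beta> c) (\<alpha> s) - D) + \<rho> D"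
        unfolding D_def using ts p
        by (intro contracting_projection_near[OF geo Z ne]) (auto simp: ray_image_def)
      \<comment> \<open>Together with the \<open>D\<close> from the image estimate this is cancelled
        by \<open>- 2 * D\<close>, so only twice the distance from \<open>\<beta> c\<close> to
        \<open>\<alpha> s\<close> remains: hence the slope 2.\<close>
      moreover have "\<rho> D \<le> D"
      proof (cases "0 \<le> \<rho> D")
        case True
        have "1 \<le> 3 * L\<^sup>2" using one_le_power[OF L, of 2] by simp
        then have "1 * \<rho> D \<le> 3 * L\<^sup>2 * \<rho> D" using True by (rule mult_right_mono)
        also have "\<dots> \<le> D"
          using far'[of c] \<open>a < c\<close> by (intro rho_le_of_kappa_le[OF \<rho>, of L A]) (simp add: D_def k_def)
        finally show ?thesis by simp
      next
        case False
        then show ?thesis using infdist_nonneg[of "\<beta> c" ?Z] by (simp add: D_def)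
      qed
      ultimately show ?thesis
        using Za c(2) dist_triangle2[of "\<alpha> s" "\<alpha> u" p] k
        by (simp add: D_def dist_commute)
    qed
    finally show ?thesis by (simp add: k_def J_def)
  qed
qed

theorem lemma4p6:
  assumes "proper_space TYPE('a::metric_space)"
    and "geodesic_space TYPE('a)"
  shows "\<exists>(M::real) (lam :: (real \<Rightarrow> real) \<Rightarrow> real \<Rightarrow> real \<Rightarrow> real).
    M \<le> 2 \<and>
    (\<forall>\<phi> \<psi> p q. sublinear \<phi> \<longrightarrow> sublinear \<psi> \<longrightarrow> (\<forall>r\<ge>0. \<phi> r = \<psi> r) \<longrightarrow> 1 \<le> p \<longrightarrow> 0 \<le> q \<longrightarrow>
      lam \<phi> p q = lam \<psi> p q) \<and>
    (\<forall>\<phi> q. sublinear \<phi> \<longrightarrow> 0 \<le> q \<longrightarrow> mono_on {1..} (\<lambda>p. lam \<phi> p q)) \<and>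
    (\<forall>\<phi> p. sublinear \<phi> \<longrightarrow> 1 \<le> p \<longrightarrow> mono_on {0..} (\<lambda>q. lam \<phi> p q)) \<and>
    (\<forall>\<rho> L A (\<alpha> :: real \<Rightarrow> 'a) \<beta> b R J x y s t.
      sublinear \<rho> \<longrightarrow> 1 \<le> L \<longrightarrow> 0 \<le> A \<longrightarrow>
      geodesic_ray \<alpha> \<longrightarrow> contracting \<rho> (ray_image \<alpha>) \<longrightarrow>
      quasi_geodesic_ray L A \<beta> \<longrightarrow> continuous_on {0..} \<beta> \<longrightarrow>
      \<alpha> 0 = b \<longrightarrow> \<beta> 0 = b \<longrightarrow>
      0 \<le> s \<longrightarrow> x = \<alpha> s \<longrightarrow> R \<le> dist x b \<longrightarrow> infdist x (ray_image \<beta>) \<le> J \<longrightarrow>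
      y = \<alpha> t \<longrightarrow> last_at_distance \<alpha> (ray_image \<beta>) (kappa \<rho> L A) s t \<longrightarrow>
      dist x y \<le> M * J + lam \<rho> L A \<and>
      dist b y \<ge> R - M * J - lam \<rho> L A)"
proof (intro exI[of _ 2] exI[of _ "\<lambda>\<phi> p q. q + 3 * kappa \<phi> p q + 2"] conjI allI impI)
  \<comment> \<open>The witness for \<open>lam\<close> is the constant of
    \<open>last_at_distance_bound\<close>, so its required properties reduce to those of
    \<open>kappa\<close>.\<close>
  fix \<phi> \<psi> :: "real \<Rightarrow> real" and p q :: real
  assume "\<forall>r\<ge>0. \<phi> r = \<psi> r"
  then show "q + 3 * kappa \<phi> p q + 2 = q + 3 * kappa \<psi> p q + 2"
    using kappa_cong[of \<phi> \<psi>] by simp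
next
  fix \<phi> :: "real \<Rightarrow> real" and q :: real
  assume "sublinear \<phi>"
  then show "mono_on {1..} (\<lambda>p. q + 3 * kappa \<phi> p q + 2)"
    by (auto intro!: mono_onI kappa_mono)
next
  fix \<phi> :: "real \<Rightarrow> real" and p :: real
  assume "sublinear \<phi>" "1 \<le> p"
  then show "mono_on {0..} (\<lambda>q. q + 3 * kappa \<phi> p q + 2)"
    by (auto intro!: mono_onI add_mono kappa_mono)
next
  fix \<rho> :: "real \<Rightarrow> real" and L A :: real and \<alpha> \<beta> :: "real \<Rightarrow> 'a" and b R J x y s t
  assume *: "sublinear \<rho>" "1 \<le> L" "0 \<le> A" "geodesic_ray \<alpha>" "contracting \<rho> (ray_image \<alpha>)"
    "quasi_geodesic_ray L A \<beta>" "continuous_on {0..} \<beta>" "\<alpha> 0 = b" "\<beta> 0 = b" "0 \<le> s" "x = \<alpha> s"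
    "R \<le> dist x b" "infdist x (ray_image \<beta>) \<le> J" "y = \<alpha> t"
    "last_at_distance \<alpha> (ray_image \<beta>) (kappa \<rho> L A) s t"
  have t: "0 \<le> t" "t \<le> s" using *(15) by (auto simp: last_at_distance_def)
  have "s - t \<le> 2 * J + (A + 3 * kappa \<rho> L A + 2)"
    using last_at_distance_bound[OF assms(2) *(1-7) _ *(15)] * by simp
  moreover have "dist x y = s - t" "dist x b = s" "dist b y = t"
    using * t unfolding geodesic_ray_def by auto
  ultimately show "dist x y \<le> 2 * J + (A + 3 * kappa \<rho> L A + 2)"
    "dist b y \<ge> R - 2 * J - (A + 3 * kappa \<rho> L A + 2)"
    using \<open>R \<le> dist x b\<close> by linarith+
qed simp

end
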